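(* Assume the update rule $U$ has $q$-linear iterate convergence with rate $q\in(0,1)$. Assume the single-scaled approach runs for $$K>\frac{5\left(\log_q(\sqrt2-1)-1\right)}{4}$$ iterations, and lazy multiscale runs for $K'=\lceil 4K/5\rceil-1$ iterations at every scale. If the finest scale has at least $I=2^S+1$ points, where $$S\;\geq\; \frac{\log\left( \dfrac{q^{-K/5-1}}{1+q^{K'}}\left( 2+\dfrac{L_{f^*}}{2(\sqrt{ 2 }(1+q^{K'}) -1)} \right) \right)}{\log\left( \dfrac{\sqrt{ 2 }}{1+q^{K'}} \right)}$$ and $L_{f^*}$ is the Lipschitz constant of the solution function $f^*$ on $[0,1]$, then lazy multiscale is cheaper and achieves a tighter expected error bound than the single-scaled approach; that is, $C_{\mathrm{LM}}<C_{\mathrm{GD}}$ and $B_{\mathrm{LM}}<B_{\mathrm{GD}}$, with the quantities defined in the context.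
   Context: Setting: a continuous problem over functions on $[0,1]$ with Lipschitz solution $f^*$ is discretized at scales $s=1,\dots,S$ (finest $s=1$), scale $s$ having $2^{S-s+1}+1$ uniformly spaced points; the scale-$s$ problem is to minimize a discretized loss $\tilde{\mathcal L}_s$ over a discretized constraint set $\tilde{\mathcal C}_s$. $q$-linear iterate convergence of $x^{k+1}=U(x^k)$ with rate $q$ means: for any initialization $x^0\in\tilde{\mathcal C}$ there is a minimizer $x^*$ of $\tilde{\mathcal L}$ over $\tilde{\mathcal C}$ (which may depend on $x^0$) such that $\lVert x^{k+1}-x^*\rVert_2\le q\lVert x^k-x^*\rVert_2$ for all $k\ge0$. The single-scaled approach performs $K$ iterations of $U$ at scale $1$ from an initialization with i.i.d. standard normal entries. Lazy multiscale starts from a random (i.i.d. standard normal) initialization at scale $S$ ($3$ points), performs $K'$ iterations of the update at each scale $s=S,\dots,1$, initializes each scale $s<S$ with the midpoint linear interpolation (the old values are kept, and the average of each two neighbouring values is inserted between them) of the result of scale $s+1$, and at scales $s<S$ updates only the $2^{S-s}$ newly interpolated points, the others being frozen. Cost model: one update at problem size $I$ costs $\Theta(I^p)$ for some fixed $p\ge1$ (for lazy multiscale the problem size at scale $s<S$ is the number $2^{S-s}$ of updated points, and at scale $S$ it is $3$); interpolation and memory allocation costs are ignored. $C_{\mathrm{GD}}=CK$ is the total cost of the single-scaled approach, where $C>0$ is its cost per iteration, and $C_{\mathrm{LM}}=\sum_{s=1}^SC_sK'$ is the total cost of lazy multiscale, where $C_s$ is the cost of one of its iterations at scale $s$. Error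 bounds: assuming the finest-scale solutions $x_1^*$ are normalized ($\lVert x_1^*\rVert_2=1$) or centered ($\lVert x_1^*\rVert_2=0$), the upper bounds on the expected final error $\mathbb{E}\lVert x_1-x_1^*\rVert_2$, where $x_1$ is the final iterate, are $$B_{\mathrm{GD}}=q^{K}\sqrt{2^S+2}$$ for the single-scaled approach and, with $d=q^{K'}$, $$B_{\mathrm{LM}}=d\left( 2(d+1)^{S-1} + \frac{L_{f^*}}{2}\, \frac{ \sqrt{2^S} ( d + 1 )^S - \sqrt{2} ( d + 1 )}{\sqrt{2^S} ( d + 1 ) ( \sqrt{2}\, d + \sqrt{2} - 1 )} \right)$$ for lazy multiscale.
   Formalization: Added: log(√2/(1+q^{K'})) > 0, i.e. q^{K'} < √2−1, which the printed bound on K does not ensure; and the Θ(I^p) cost is assumed to have cost(I)/I^p nondecreasing in I (e.g. cost = c·I^p), since a bare Θ does not give C_LM < C_GD. *)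

theory Defs
  imports "HOL-Analysis.Analysis" "HOL-Library.Landau_Symbols"
begin

text \<open>
  The dimension of the discretized problems depends on the scale, so vectors of length \<open>n\<close> are
  represented as extensional functions on \<open>{..<n}\<close>; their Euclidean norm is \<open>L2_set x {..<n}\<close>.
\<close>

definition vectors :: "nat \<Rightarrow> (nat \<Rightarrow> real) set" where
  "vectors n = {..<n} \<rightarrow>\<^sub>E UNIV"

definition num_points :: "nat \<Rightarrow> nat \<Rightarrow> nat" where
  "num_points S s = 2 ^ (S - s + 1) + 1"

abbreviation minimizer :: "('a \<Rightarrow> real) \<Rightarrow> 'a set \<Rightarrow> 'a \<Rightarrow> bool" where
  "minimizer loss C x \<equiv> is_arg_min loss (\<lambda>y. y \<in> C) x"

definition q_linear_iterate_convergence ::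
  "nat \<Rightarrow> ((nat \<Rightarrow> real) \<Rightarrow> real) \<Rightarrow> (nat \<Rightarrow> real) set
    \<Rightarrow> ((nat \<Rightarrow> real) \<Rightarrow> (nat \<Rightarrow> real)) \<Rightarrow> real \<Rightarrow> bool" where
  "q_linear_iterate_convergence n loss C U q \<longleftrightarrow>
    (\<forall>x0\<in>C. \<exists>xs. minimizer loss C xs \<and>
      (\<forall>k. L2_set (\<lambda>i. (U ^^ Suc k) x0 i - xs i) {..<n}
            \<le> q * L2_set (\<lambda>i. (U ^^ k) x0 i - xs i) {..<n}))"

text \<open>
  Below, \<open>cost I\<close> is the cost of one update at problem size \<open>I\<close>. At the coarsest scale lazy
  multiscale updates all \<open>3\<close> points, at the other scales only the newly interpolated ones.
\<close>

definition lazy_size :: "nat \<Rightarrow> nat \<Rightarrow> nat" where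
  "lazy_size S s = (if s = S then 3 else 2 ^ (S - s))"

definition cost_single :: "(nat \<Rightarrow> real) \<Rightarrow> nat \<Rightarrow> nat \<Rightarrow> real" where
  "cost_single cost S K = cost (num_points S 1) * real K"

definition cost_lazy :: "(nat \<Rightarrow> real) \<Rightarrow> nat \<Rightarrow> nat \<Rightarrow> real" where
  "cost_lazy cost S K' = (\<Sum>s=1..S. cost (lazy_size S s) * real K')"

text \<open>
  The upper bounds on the expected final error, for a standard normal initialization, after \<open>K\<close>
  iterations at the finest scale and after \<open>K'\<close> iterations at each of the \<open>S\<close> scales; \<open>L\<close> is the
  Lipschitz constant of the continuous solution.
\<close>

definition bound_single :: "real \<Rightarrow> nat \<Rightarrow> nat \<Rightarrow> real" where
  "bound_single q S K = q ^ K * sqrt (2 ^ S + 2)"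

definition bound_lazy :: "real \<Rightarrow> real \<Rightarrow> nat \<Rightarrow> nat \<Rightarrow> real" where
  "bound_lazy q L S K' = (let d = q ^ K' in
     d * (2 * (d + 1) ^ (S - 1)
          + L / 2 * ((sqrt (2 ^ S) * (d + 1) ^ S - sqrt 2 * (d + 1))
                     / (sqrt (2 ^ S) * (d + 1) * (sqrt 2 * d + sqrt 2 - 1)))))"

end

theory Submission
  imports Defs
begin

text \<open>
  The sizes of the lazy updates add up to the full size \<open>2 ^ S + 1\<close>, so superadditivity of \<open>I powr p\<close>
  makes one iteration at every scale no more expensive than one iteration at the finest scale;
  strictness comes from \<open>K' < 4 K / 5\<close>. For the bounds, \<open>K' \<ge> 4 K / 5 - 1\<close> reduces the claim to
  an inequality between \<open>sqrt (2 ^ S)\<close> and a multiple of \<open>(1 + q ^ K') ^ (S - 1)\<close>, which is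
  the exponentiated form of the condition on \<open>S\<close>.
\<close>

text \<open>Every point of the finest grid is updated at exactly one scale: it is one of the 3
  coarsest points or is inserted at a single later scale. In numbers, 3 + (2 + 4 + ... + 2^(S-1)) =
  2^S + 1.\<close>

lemma sum_lazy_size:
  assumes "S \<ge> 1"
  shows "(\<Sum>s=1..S. lazy_size S s) = num_points S 1"
proof -
  have "(\<Sum>s=1..S. lazy_size S s) = 3 + (\<Sum>s=1..<S. 2 ^ (S - s))"
    using assms by (simp add: lazy_size_def atLeastLessThanSuc_atLeastAtMost[symmetric])
  also have "(\<Sum>s=1..<S. 2 ^ (S - s)) = (\<Sum>s=1..<S. 2 ^ s :: nat)"
    by (rule sum.reindex_bij_witness[where i = "\<lambda>s. S - s" and j = "\<lambda>s. S - s"]) auto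
  also have "3 + \<dots> = 2 ^ S + 1"
    using assms
  proof (induction S rule: dec_induct)
    case (step n)
    then show ?case by simp
  qed simp
  finally show ?thesis
    using assms by (simp add: num_points_def)
qed

text \<open>Since \<open>p \<ge> 1\<close> and the factor in front of \<open>I powr p\<close> does
  not decrease with the size, a lazy update of size n costs at most the share n / N of a full update
  of size N. By \<open>sum_lazy_size\<close> these shares add up to 1.\<close>

lemma cost_lazy_le:
  fixes cost :: "nat \<Rightarrow> real"
  assumes "S \<ge> 1" "p \<ge> 1" "cost (num_points S 1) \<ge> 0"
    and mono: "\<And>I J. 1 \<le> I \<Longrightarrow> I \<le> J \<Longrightarrow> cost I / real I powr p \<le> cost J / real J powr p"
  shows "cost_lazy cost S K' \<le> cost (num_points S 1) * real K'"
proof -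
  define N where "N = num_points S 1"
  have N: "N > 0" by (simp add: N_def num_points_def)
  have le: "cost (lazy_size S s) \<le> cost N / real N * real (lazy_size S s)"
    if "s \<in> {1..S}" for s
  proof -
    define n where "n = lazy_size S s"
    have n: "n \<ge> 1" by (simp add: n_def lazy_size_def)
    have "n \<le> N"
      unfolding n_def N_def sum_lazy_size[OF assms(1), symmetric]
      using that by (intro member_le_sum) auto
    have "cost n = cost n / real n powr p * real n powr p"
      using n by simp
    also have "\<dots> \<le> cost N / real N powr p * real n powr p"
      using mono[OF n \<open>n \<le> N\<close>] by (intro mult_right_mono) auto
    \<comment> \<open>One factor n stays, so that the bound is linear in the size and can be summed;
      the rest has exponent p - 1 \<ge> 0 and may be enlarged to N.\<close>
    also have "real n powr p = real n * real n powr (p - 1)"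
      using n by (simp add: powr_diff)
    also have "cost N / real N powr p * \<dots> \<le> cost N / real N powr p * (real n * real N powr (p - 1))"
      using assms \<open>n \<le> N\<close> n
      by (intro mult_left_mono powr_mono2) (auto simp: N_def)
    also have "\<dots> = cost N / real N * real n"
      using N by (simp add: powr_diff)
    finally show ?thesis by (simp add: n_def)
  qed
  have "cost_lazy cost S K' \<le> (\<Sum>s=1..S. cost N / real N * real (lazy_size S s) * real K')"
    unfolding cost_lazy_def by (intro sum_mono mult_right_mono le) auto
  also have "\<dots> = cost N / real N * real (\<Sum>s=1..S. lazy_size S s) * real K'"
    by (simp add: sum_distrib_left sum_distrib_right)
  also have "\<dots> = cost N * real K'"
    unfolding sum_lazy_size[OF assms(1)] N_def[symmetric] using N by simp
  finally show ?thesis by (simp add: N_def)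
qed

text \<open>Dropping the subtracted \<open>sqrt 2 * r\<close> from the numerator lets
  \<open>sqrt (2 ^ S)\<close> cancel and leaves r^S / r, so that both terms of the bound share the
  factor \<open>r ^ (S - 1)\<close>.\<close>

lemma bound_lazy_le:
  fixes q L :: real and S K' :: nat
  assumes "S \<ge> 1" "q > 0" "L \<ge> 0"
  defines "r \<equiv> 1 + q ^ K'"
  shows "bound_lazy q L S K' \<le> q ^ K' * (r ^ (S - 1) * (2 + L / (2 * (sqrt 2 * r - 1))))"
proof -
  have r: "r > 1" using assms by simp
  have w: "sqrt 2 * r - 1 > 0"
    using mult_strict_mono[of 1 "sqrt 2" 1 r] r by simp
  have rS: "r ^ S = r * r ^ (S - 1)"
    using assms(1) by (cases S) auto
  have "(sqrt (2 ^ S) * r ^ S - sqrt 2 * r) / (sqrt (2 ^ S) * r * (sqrt 2 * r - 1))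
      \<le> (sqrt (2 ^ S) * r ^ S) / (sqrt (2 ^ S) * r * (sqrt 2 * r - 1))"
    using r w by (intro divide_right_mono) auto
  also have "\<dots> = r ^ (S - 1) / (sqrt 2 * r - 1)"
    using r w by (simp add: rS)
  finally have "L / 2 * ((sqrt (2 ^ S) * r ^ S - sqrt 2 * r) / (sqrt (2 ^ S) * r * (sqrt 2 * r - 1)))
      \<le> L / 2 * (r ^ (S - 1) / (sqrt 2 * r - 1))"
    using assms by (intro mult_left_mono) auto
  moreover have "bound_lazy q L S K' = q ^ K' * (2 * r ^ (S - 1)
      + L / 2 * ((sqrt (2 ^ S) * r ^ S - sqrt 2 * r) / (sqrt (2 ^ S) * r * (sqrt 2 * r - 1))))"
    by (simp add: bound_lazy_def Let_def r_def algebra_simps)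
  moreover have "r ^ (S - 1) * (2 + L / (2 * (sqrt 2 * r - 1)))
      = 2 * r ^ (S - 1) + L / 2 * (r ^ (S - 1) / (sqrt 2 * r - 1))"
    by (simp add: algebra_simps)
  ultimately show ?thesis
    using assms by (auto intro!: mult_left_mono)
qed

theorem corollary5p8:
  fixes q p L :: real and S K K' :: nat
    and cont_loss :: "(real \<Rightarrow> real) \<Rightarrow> real" and cont_set :: "(real \<Rightarrow> real) set"
    and f_sol :: "real \<Rightarrow> real"
    and loss :: "nat \<Rightarrow> (nat \<Rightarrow> real) \<Rightarrow> real" and C :: "nat \<Rightarrow> (nat \<Rightarrow> real) set"
    and U :: "nat \<Rightarrow> (nat \<Rightarrow> real) \<Rightarrow> (nat \<Rightarrow> real)"
    and cost :: "nat \<Rightarrow> real"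
  assumes scales: "S \<ge> 1"
    and cont_set: "cont_set \<subseteq> {0..1} \<rightarrow>\<^sub>E UNIV"
    and f_sol: "minimizer cont_loss cont_set f_sol"
    and lipschitz: "L-lipschitz_on {0..1} f_sol"
    and sets: "\<And>s. s \<in> {1..S} \<Longrightarrow> C s \<subseteq> vectors (num_points S s)"
    and update: "\<And>s. s \<in> {1..S} \<Longrightarrow>
      U s \<in> vectors (num_points S s) \<rightarrow> vectors (num_points S s)"
    and normalized_or_centered:
      "(\<forall>x. minimizer (loss 1) (C 1) x \<longrightarrow> L2_set x {..<num_points S 1} = 1) \<or>
       (\<forall>x. minimizer (loss 1) (C 1) x \<longrightarrow> L2_set x {..<num_points S 1} = 0)"
    and rate: "0 < q" "q < 1"
    and convergence: "\<And>s. s \<in> {1..S} \<Longrightarrow>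
      q_linear_iterate_convergence (num_points S s) (loss s) (C s) (U s) q"
    and cost: "p \<ge> 1" "cost \<in> \<Theta>(\<lambda>I. real I powr p)" "cost (num_points S 1) > 0"
    and cost_factor_mono: "\<And>I J. 1 \<le> I \<Longrightarrow> I \<le> J \<Longrightarrow>
      cost I / real I powr p \<le> cost J / real J powr p"
    and K: "real K > 5 * (log q (sqrt 2 - 1) - 1) / 4"
    and K': "int K' = \<lceil>4 * real K / 5\<rceil> - 1"
    and denominator_pos: "ln (sqrt 2 / (1 + q ^ K')) > 0"
    and S: "real S \<ge>
      ln (q powr (- real K / 5 - 1) / (1 + q ^ K')
            * (2 + L / (2 * (sqrt 2 * (1 + q ^ K') - 1))))
      / ln (sqrt 2 / (1 + q ^ K'))"
  shows "cost_lazy cost S K' < cost_single cost S K \<and>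
         bound_lazy q L S K' < bound_single q S K"
proof
  \<comment> \<open>A ceiling minus 1 lies strictly below its argument, here 4K/5.\<close>
  have "real K' < real K"
    using K' by linarith
  have "cost_lazy cost S K' \<le> cost (num_points S 1) * real K'"
    by (rule cost_lazy_le[OF scales cost(1) less_imp_le[OF cost(3)] cost_factor_mono])
  also have "\<dots> < cost (num_points S 1) * real K"
    using \<open>real K' < real K\<close> cost(3) by (rule mult_strict_left_mono)
  finally show "cost_lazy cost S K' < cost_single cost S K"
    by (simp add: cost_single_def)
next
  have K'_ge: "real K' \<ge> 4 * real K / 5 - 1"
    using K' by linarith
  have L: "L \<ge> 0" using lipschitz by (rule lipschitz_on_nonneg)
  define r where "r = 1 + q ^ K'"
  define A where "A = 2 + L / (2 * (sqrt 2 * r - 1))"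
  have r: "r > 1" using rate by (simp add: r_def)
  have "sqrt 2 * r > 1" using mult_strict_mono[of 1 "sqrt 2" 1 r] r by simp
  then have A: "A > 0" using L by (simp add: A_def add_pos_nonneg)
  have rS: "r ^ S = r * r ^ (S - 1)" using scales by (cases S) auto
  \<comment> \<open>The condition on S is multiplied by its denominator, which is positive because r
    < sqrt 2.\<close>
  have "ln (q powr (- real K / 5 - 1) / r * A) \<le> real S * ln (sqrt 2 / r)"
    using S denominator_pos by (simp add: r_def A_def pos_divide_le_eq)
  also have "\<dots> = ln ((sqrt 2 / r) ^ S)"
    using r by (simp add: ln_realpow)
  finally have "q powr (- real K / 5 - 1) / r * A \<le> (sqrt 2 / r) ^ S"
    using r A rate by simp
  \<comment> \<open>Both sides are multiplied by \<open>r ^ S\<close>; one of its factors cancels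
    the division by r.\<close>
  then have main: "q powr (- real K / 5 - 1) * (r ^ (S - 1) * A) \<le> sqrt (2 ^ S)"
    using r by (simp add: power_divide rS real_sqrt_power field_simps)
  have "bound_lazy q L S K' \<le> q ^ K' * (r ^ (S - 1) * A)"
    unfolding r_def A_def by (rule bound_lazy_le[OF scales rate(1) L])
  also have "q ^ K' = q powr real K'"
    using rate by (simp add: powr_realpow)
  \<comment> \<open>Powers of q < 1 decrease in the exponent, and 4K/5 - 1 is written as K + (-K/5 -
    1) to split off \<open>q ^ K\<close> and leave the left side of \<open>main\<close>.\<close>
  also have "\<dots> * (r ^ (S - 1) * A) \<le> q powr (real K + (- real K / 5 - 1)) * (r ^ (S - 1) * A)"
    using K'_ge rate r A by (intro mult_right_mono powr_mono') auto
  also have "\<dots> = q ^ K * (q powr (- real K / 5 - 1) * (r ^ (S - 1) * A))"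
    unfolding powr_add using rate by (simp add: powr_realpow)
  also have "\<dots> \<le> q ^ K * sqrt (2 ^ S)"
    using main rate by (intro mult_left_mono) auto
  \<comment> \<open>Strictness comes from the summand 2 under the root in
    \<open>bound_single\<close>.\<close>
  also have "\<dots> < bound_single q S K"
    using rate by (simp add: bound_single_def)
  finally show "bound_lazy q L S K' < bound_single q S K" .
qed

end
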